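(* Let $p>3$ be prime, $q=p^r$ with $r$ even, and let $E_1,E_2$ be supersingular elliptic curves defined over $\mathbb{F}_q$ with $j(E_1)=j(E_2)=1728$. Then $\#E_1(\mathbb{F}_q)=\#E_2(\mathbb{F}_q)$ if and only if $E_1(\mathbb{F}_q)\cong E_2(\mathbb{F}_q)$ as groups.
   Context: For $E:y^2=x^3+Ax+B$ the $j$-invariant is $j(E)=1728\cdot\frac{4A^3}{4A^3+27B^2}$; $j(E)=1728$ means $E$ has the form $y^2=x^3+ax$. $E$ over $\mathbb{F}_q$ is supersingular if $\#E(\mathbb{F}_q)\equiv 1\pmod p$. $E(\mathbb{F}_q)$ denotes the group of $\mathbb{F}_q$-rational points. *)

theory Defs
  imports
    "HOL-Library.Cardinality"
    "HOL-Algebra.Group"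
    "HOL-Number_Theory.Cong"
    "HOL-Computational_Algebra.Primes"
begin

text \<open>
  Short Weierstrass curves \<open>y\<^sup>2 = x\<^sup>3 + A x + B\<close> over the field given by the type \<open>'a\<close>.
  These are the usual notions in characteristic different from 2 and 3 only.
\<close>

datatype 'a curve = Curve (coeff_A: 'a) (coeff_B: 'a)

datatype 'a point = Infinity | Affine 'a 'a

definition elliptic_curve :: "'a::field curve \<Rightarrow> bool" where
  "elliptic_curve E \<longleftrightarrow> 4 * coeff_A E ^ 3 + 27 * coeff_B E ^ 2 \<noteq> 0"

definition j_invariant :: "'a::field curve \<Rightarrow> 'a" where
  "j_invariant E =
     1728 * (4 * coeff_A E ^ 3 / (4 * coeff_A E ^ 3 + 27 * coeff_B E ^ 2))"

definition rational_points :: "'a::field curve \<Rightarrow> 'a point set" where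
  "rational_points E =
     insert Infinity {Affine x y | x y. y ^ 2 = x ^ 3 + coeff_A E * x + coeff_B E}"

text \<open>
  The chord-and-tangent law. For points of the curve, \<open>x\<^sub>1 = x\<^sub>2\<close> leaves only the cases
  \<open>y\<^sub>1 = - y\<^sub>2\<close> (opposite points, including the points of order two) and \<open>y\<^sub>1 = y\<^sub>2 \<noteq> 0\<close>
  (doubling, with the slope of the tangent).
\<close>

fun point_add :: "'a::field curve \<Rightarrow> 'a point \<Rightarrow> 'a point \<Rightarrow> 'a point" where
  "point_add E Infinity Q = Q"
| "point_add E P Infinity = P"
| "point_add E (Affine x1 y1) (Affine x2 y2) =
     (if x1 = x2 \<and> y1 = - y2 then Infinity
      else
        let m = (if x1 = x2 then (3 * x1 ^ 2 + coeff_A E) / (2 * y1)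
                 else (y2 - y1) / (x2 - x1));
            x3 = m ^ 2 - x1 - x2
        in Affine x3 (m * (x1 - x3) - y1))"

definition point_group :: "'a::field curve \<Rightarrow> 'a point monoid" where
  "point_group E =
     \<lparr>carrier = rational_points E, monoid.mult = point_add E, one = Infinity\<rparr>"

definition supersingular :: "'a::finite_field curve \<Rightarrow> bool" where
  "supersingular E \<longleftrightarrow> [card (rational_points E) = 1] (mod CHAR('a))"

end

theory Submission
  imports Defs "HOL-Number_Theory.Residues" "HOL-Computational_Algebra.Nth_Powers"
    "HOL-Computational_Algebra.Polynomial"
begin

text \<open>
  The curves are \<open>y\<^sup>2 = x\<^sup>3 + a x\<close> and \<open>y\<^sup>2 = x\<^sup>3 + b x\<close>. Point counts are \<open>0\<close> modulo 4 for
  square \<open>a\<close> and \<open>2\<close> otherwise, so equal counts force \<open>b = e\<^sup>2 a\<close> for some \<open>e\<close>. If \<open>e\<close> is a square,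
  the curves are isomorphic. Otherwise they are quadratic twists of each other, so the common
  count is \<open>q + 1\<close>, which is \<open>2\<close> modulo 4, and \<open>a\<close> is not a square. Supersingularity forces \<open>p\<close> to be
  \<open>3\<close> modulo 4; then \<open>b\<close> is \<open>a\<^sup>p\<close> times a fourth power, and Frobenius \<open>(x, y) \<mapsto> (x\<^sup>p, y\<^sup>p)\<close> followed
  by a scaling is an isomorphism of the groups, although the curves need not be isomorphic
  over the field.
\<close>

section \<open>Isomorphisms of curves and their point groups\<close>

text \<open>The identity gives ordinary scalings of a curve. Frobenius also reaches curves whose
  point groups are isomorphic although no scaling over the field need relate them.\<close>

locale field_automorphism =
  fixes f :: "'a::field \<Rightarrow> 'a"
  assumes add: "f (x + y) = f x + f y"
    and mult: "f (x * y) = f x * f y"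
    and bij: "bij f"
begin

lemma zero [simp]: "f 0 = 0"
  using add[of 0 0] by (metis add_cancel_right_right)

lemma eq_iff [simp]: "f x = f y \<longleftrightarrow> x = y"
  using bij by (simp add: bij_def inj_eq)

lemma eq_0_iff [simp]: "f x = 0 \<longleftrightarrow> x = 0"
  using eq_iff[of x 0] by simp

lemma one [simp]: "f 1 = 1"
  using mult[of 1 1] by simp

lemma minus: "f (- x) = - f x"
  using add[of x "- x"] by (simp add: eq_neg_iff_add_eq_0 add.commute)

lemma diff: "f (x - y) = f x - f y"
  using add[of x "- y"] by (simp add: minus)

lemma divide: "f (x / y) = f x / f y"
proof (cases "y = 0")
  case False
  then show ?thesis
    using mult[of "x / y" y] by (simp add: field_simps)
qed simp

lemma power: "f (x ^ n) = f x ^ n"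
  by (induction n) (simp_all add: mult)

lemma numeral [simp]: "f (numeral k) = numeral k"
  by (induction k) (simp_all only: numeral.simps add one)

lemmas hom_simps = add mult minus diff divide power

end

text \<open>The automorphism \<open>f\<close> applied to coordinates, followed by the usual change
  of variables that gives x weight 2 and y weight 3.\<close>

primrec scale_point :: "('a::field \<Rightarrow> 'a) \<Rightarrow> 'a \<Rightarrow> 'a point \<Rightarrow> 'a point" where
  "scale_point f u Infinity = Infinity"
| "scale_point f u (Affine x y) = Affine (u ^ 2 * f x) (u ^ 3 * f y)"

context field_automorphism
begin

text \<open>The addition formulas are rational expressions over the integers, so \<open>f\<close>
  commutes with them. They are homogeneous for the weights 2, 3, 4 of x, y, a, so scaling by
  \<open>u\<close> commutes as well.\<close>

lemma scale_point_add:
  assumes "u \<noteq> 0"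
  shows "scale_point f u (point_add (Curve a b) P Q)
    = point_add (Curve (u ^ 4 * f a) (u ^ 6 * f b)) (scale_point f u P) (scale_point f u Q)"
proof (cases "P = Infinity \<or> Q = Infinity")
  case True
  then show ?thesis by (cases P; cases Q) auto
next
  case False
  then obtain x1 y1 x2 y2 where PQ: "P = Affine x1 y1" "Q = Affine x2 y2"
    by (metis point.exhaust)
  define m where "m = (if x1 = x2 then (3 * x1 ^ 2 + a) / (2 * y1) else (y2 - y1) / (x2 - x1))"
  define m' where "m' = (if u ^ 2 * f x1 = u ^ 2 * f x2
      then (3 * (u ^ 2 * f x1) ^ 2 + u ^ 4 * f a) / (2 * (u ^ 3 * f y1))
      else (u ^ 3 * f y2 - u ^ 3 * f y1) / (u ^ 2 * f x2 - u ^ 2 * f x1))"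
  \<comment> \<open>The slope has weight 1. A vanishing denominator does no harm: division by zero
    gives 0 on both sides.\<close>
  have slope: "m' = u * f m"
  proof (cases "x1 = x2")
    case True
    have "3 * (u ^ 2 * f x1) ^ 2 + u ^ 4 * f a = u ^ 3 * (u * (3 * f x1 ^ 2 + f a))"
      by (simp add: algebra_simps eval_nat_numeral)
    then show ?thesis
      using True assms unfolding m_def m'_def by (simp add: hom_simps mult.left_commute)
  next
    case False
    have "u ^ 3 * f y2 - u ^ 3 * f y1 = u ^ 2 * (u * (f y2 - f y1))"
      "u ^ 2 * f x2 - u ^ 2 * f x1 = u ^ 2 * (f x2 - f x1)"
      by (simp_all add: algebra_simps eval_nat_numeral)
    then show ?thesis
      using False assms unfolding m_def m'_def by (simp add: hom_simps)
  qed
  have eq_y: "u ^ 3 * f y1 = - (u ^ 3 * f y2) \<longleftrightarrow> y1 = - y2"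
    using assms by (simp flip: mult_minus_right minus)
  have eq_x: "u ^ 2 * f x1 = u ^ 2 * f x2 \<longleftrightarrow> x1 = x2"
    using assms by simp
  have sum: "point_add (Curve a b) P Q = (if x1 = x2 \<and> y1 = - y2 then Infinity
    else Affine (m ^ 2 - x1 - x2) (m * (x1 - (m ^ 2 - x1 - x2)) - y1))"
    unfolding PQ m_def by (simp only: point_add.simps Let_def curve.sel)
  have sum': "point_add (Curve (u ^ 4 * f a) (u ^ 6 * f b)) (scale_point f u P) (scale_point f u Q)
    = (if u ^ 2 * f x1 = u ^ 2 * f x2 \<and> u ^ 3 * f y1 = - (u ^ 3 * f y2) then Infinity
       else Affine (m' ^ 2 - u ^ 2 * f x1 - u ^ 2 * f x2)
         (m' * (u ^ 2 * f x1 - (m' ^ 2 - u ^ 2 * f x1 - u ^ 2 * f x2)) - u ^ 3 * f y1))"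
    unfolding PQ m'_def by (simp only: scale_point.simps point_add.simps Let_def curve.sel)
  have "m' ^ 2 - u ^ 2 * f x1 - u ^ 2 * f x2 = u ^ 2 * f (m ^ 2 - x1 - x2)"
    unfolding slope by (simp add: hom_simps algebra_simps)
  moreover have "m' * (u ^ 2 * f x1 - u ^ 2 * f z) - u ^ 3 * f y1 = u ^ 3 * f (m * (x1 - z) - y1)" for z
    unfolding slope by (simp add: hom_simps algebra_simps power2_eq_square power3_eq_cube)
  ultimately show ?thesis
    unfolding sum sum' eq_x eq_y by (simp only: scale_point.simps split: if_split) simp
qed

lemma scale_point_in_rational_points_iff:
  assumes "u \<noteq> 0"
  shows "scale_point f u P \<in> rational_points (Curve (u ^ 4 * f a) (u ^ 6 * f b))
    \<longleftrightarrow> P \<in> rational_points (Curve a b)"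
proof (cases P)
  case (Affine x y)
  have "(u ^ 3 * f y) ^ 2 = (u ^ 2 * f x) ^ 3 + u ^ 4 * f a * (u ^ 2 * f x) + u ^ 6 * f b
    \<longleftrightarrow> u ^ 6 * f (y ^ 2) = u ^ 6 * f (x ^ 3 + a * x + b)"
    by (simp add: hom_simps algebra_simps flip: power_mult power_add)
  then show ?thesis
    using assms by (simp add: Affine rational_points_def)
qed (simp add: rational_points_def)

lemma inj_scale_point:
  assumes "u \<noteq> 0"
  shows "inj (scale_point f u)"
proof (rule injI)
  fix P Q
  assume "scale_point f u P = scale_point f u Q"
  then show "P = Q"
    using assms by (cases P; cases Q) auto
qed

lemma surj_scale_point:
  assumes "u \<noteq> 0"
  shows "surj (scale_point f u)"
proof (rule surjI)
  fix P
  show "scale_point f u (case P of Infinity \<Rightarrow> Infinity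
    | Affine x y \<Rightarrow> Affine (inv_into UNIV f (x / u ^ 2)) (inv_into UNIV f (y / u ^ 3))) = P"
    using assms bij by (cases P) (simp_all add: bij_def surj_f_inv_f)
qed

lemma point_group_iso:
  assumes "u \<noteq> 0"
  shows "point_group (Curve a b) \<cong> point_group (Curve (u ^ 4 * f a) (u ^ 6 * f b))"
proof -
  let ?E = "Curve a b" and ?E' = "Curve (u ^ 4 * f a) (u ^ 6 * f b)"
  \<comment> \<open>Membership is reflected as well as preserved, so surjectivity on all points
    gives surjectivity onto the second curve.\<close>
  have "rational_points ?E = scale_point f u -` rational_points ?E'"
    using scale_point_in_rational_points_iff[OF assms] by blast
  then have "scale_point f u ` rational_points ?E = rational_points ?E'"
    using surj_scale_point[OF assms] by (simp add: surj_image_vimage_eq)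
  then have "bij_betw (scale_point f u) (rational_points ?E) (rational_points ?E')"
    using inj_scale_point[OF assms] by (auto simp: bij_betw_def intro: inj_on_subset)
  then have "scale_point f u \<in> iso (point_group ?E) (point_group ?E')"
    using scale_point_add[OF assms] scale_point_in_rational_points_iff[OF assms]
    by (auto simp: iso_def hom_def point_group_def)
  then show ?thesis
    by (auto simp: is_iso_def)
qed

end

lemma field_automorphism_id: "field_automorphism (\<lambda>x::'a::field. x)"
  by standard (simp_all add: bij_def)

lemma field_automorphism_Frobenius: "field_automorphism (\<lambda>x::'a::finite_field. x ^ CHAR('a))"
proof
  have "inj (\<lambda>x::'a. x ^ CHAR('a))"
  proof (rule injI)
    fix x y :: 'a
    assume "x ^ CHAR('a) = y ^ CHAR('a)"
    \<comment> \<open>The freshman's dream is applied to the sum (x - y) + y.\<close>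
    then have "(x - y) ^ CHAR('a) = 0"
      using freshmans_dream[of "CHAR('a)" "x - y" y] by simp
    then show "x = y" by simp
  qed
  then show "bij (\<lambda>x::'a. x ^ CHAR('a))"
    by (simp add: bij_def finite_UNIV_inj_surj)
qed (simp_all add: freshmans_dream power_mult_distrib)

section \<open>Squares and power sums in finite fields\<close>

lemma finite_field_power_eq_1:
  fixes x :: "'a::finite_field"
  assumes "CARD('a) = Suc k" "x \<noteq> 0"
  shows "x ^ k = 1"
  using finite_field_power_card_eq_same[of x] assms by simp

text \<open>The elements are roots of the nonzero polynomial X^k - 1.\<close>

lemma card_power_eq_1_le:
  assumes "k > 0"
  shows "card {x::'a::field. x ^ k = 1} \<le> k"
proof -
  have "coeff (Polynomial.monom 1 k - 1 :: 'a poly) k \<noteq> 0"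
    using assms by simp
  then have "Polynomial.monom 1 k - 1 \<noteq> (0 :: 'a poly)"
    by (metis coeff_0)
  moreover have "degree (Polynomial.monom 1 k - 1 :: 'a poly) \<le> k"
    by (intro degree_diff_le) (simp_all add: degree_monom_le)
  ultimately show ?thesis
    using card_poly_roots_bound[of "Polynomial.monom 1 k - 1 :: 'a poly"] by (simp add: poly_monom)
qed

lemma finite_field_two_neq_0:
  assumes "odd CARD('a::finite_field)"
  shows "(2::'a) \<noteq> 0"
proof
  assume "(2::'a) = 0"
  then have "CHAR('a) dvd 2"
    by (metis of_nat_numeral of_nat_eq_0_iff_char_dvd)
  then have "CHAR('a) = 2"
    by (metis CHAR_prime primes_dvd_imp_eq two_is_prime_nat)
  then show False
    using CHAR_dvd_CARD[where 'a='a] assms by simp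
qed

lemma card_square_roots:
  fixes c :: "'a::finite_field"
  assumes "odd CARD('a)"
  shows "card {y. y ^ 2 = c} = (if c = 0 then 1 else if is_square c then 2 else 0)"
proof (cases "is_square c")
  case True
  then obtain s where s: "c = s ^ 2"
    by (auto elim: is_nth_powerE)
  have "{y. y ^ 2 = c} = {s, - s}"
    using s by (auto simp: power2_eq_iff)
  moreover have "s = - s \<longleftrightarrow> s = 0"
    using finite_field_two_neq_0[OF assms] by (metis add_eq_0_iff mult_2 mult_eq_0_iff)
  ultimately show ?thesis
    using s True by auto
next
  case False
  then show ?thesis by (auto simp: is_nth_power_def)
qed

lemma card_fibres:
  fixes h :: "'a::finite \<Rightarrow> 'b::finite"
  shows "(\<Sum>c\<in>UNIV. card {y. h y = c}) = CARD('a)"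
proof -
  have "(\<Sum>c\<in>UNIV. card {y. h y = c}) = card (\<Union>c\<in>UNIV. {y. h y = c})"
    by (rule card_UN_disjoint[symmetric]) auto
  also have "(\<Union>c\<in>UNIV. {y. h y = c}) = UNIV" by auto
  finally show ?thesis .
qed

text \<open>Counting the field along the fibres of squaring: 0 has one root, every nonzero square
  has two.\<close>

lemma card_nonzero_squares:
  assumes "CARD('a::finite_field) = 2 * n + 1"
  shows "card {c::'a. c \<noteq> 0 \<and> is_square c} = n"
proof -
  have "CARD('a) = (\<Sum>c\<in>UNIV. card {y::'a. y ^ 2 = c})"
    by (rule card_fibres[symmetric])
  also have "\<dots> = (\<Sum>c\<in>UNIV. if c = (0::'a) then 1 else if is_square c then 2 else 0)"
    using assms by (intro sum.cong) (auto simp: card_square_roots)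
  also have "\<dots> = (\<Sum>c\<in>UNIV. (if c = (0::'a) then 1 else 0) + (if c \<noteq> 0 \<and> is_square c then 2 else 0))"
    by (intro sum.cong) auto
  also have "\<dots> = 1 + 2 * card {c::'a. c \<noteq> 0 \<and> is_square c}"
    by (simp add: sum.distrib flip: sum.inter_filter)
  finally show ?thesis using assms by simp
qed

text \<open>The n nonzero squares all satisfy x^n = 1, which has at most n solutions, so they are
  exactly the solutions. Elsewhere c^n is the other square root of 1.\<close>

lemma euler_criterion_finite_field:
  fixes c :: "'a::finite_field"
  assumes card: "CARD('a) = 2 * n + 1" and "c \<noteq> 0"
  shows "c ^ n = (if is_square c then 1 else - 1)"
proof -
  have "CARD('a) > 1"
    using card_mono[of "UNIV :: 'a set" "{0, 1}"] by simp
  then have n: "n > 0" using card by simp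
  have sub: "{c::'a. c \<noteq> 0 \<and> is_square c} \<subseteq> {x. x ^ n = 1}"
    using finite_field_power_eq_1[of "2 * n"] card
    by (auto simp: is_nth_power_def simp flip: power_mult)
  then have eq: "{c::'a. c \<noteq> 0 \<and> is_square c} = {x. x ^ n = 1}"
    using card_power_eq_1_le[OF n, where 'a='a] card_nonzero_squares[OF card]
    by (intro card_subset_eq) (auto simp: le_antisym card_mono dest: card_mono[rotated])
  have "(c ^ n) ^ 2 = 1"
    using finite_field_power_eq_1[of "2 * n" c] assms by (simp add: mult.commute flip: power_mult)
  then have "c ^ n = 1 \<or> c ^ n = - 1"
    by (simp add: power2_eq_1_iff)
  moreover have "is_square c \<longleftrightarrow> c ^ n = 1"
    using eq \<open>c \<noteq> 0\<close> by auto
  ultimately show ?thesis by auto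
qed

text \<open>By Euler's criterion, being a square is read off from the multiplicative map c \<mapsto>
  c^n with the distinct values 1 and -1.\<close>

lemma is_square_mult_iff:
  fixes c d :: "'a::finite_field"
  assumes "odd CARD('a)" "c \<noteq> 0" "d \<noteq> 0"
  shows "is_square (c * d) \<longleftrightarrow> (is_square c \<longleftrightarrow> is_square d)"
proof -
  obtain n where n: "CARD('a) = 2 * n + 1"
    using assms(1) by (elim oddE)
  have "(- 1 :: 'a) \<noteq> 1"
    using finite_field_two_neq_0[OF assms(1)] by (metis add.right_inverse one_add_one)
  moreover have "(c * d) ^ n = c ^ n * d ^ n"
    by (rule power_mult_distrib)
  ultimately show ?thesis
    using euler_criterion_finite_field[OF n] assms
    by (auto split: if_splits)
qed

text \<open>If k divides e, each of the k = q - 1 nonzero x contributes 1. Otherwise some nonzero g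
  has g^e \<noteq> 1, and replacing x by g x multiplies the sum by g^e, so it vanishes.\<close>

lemma sum_powers_finite_field:
  assumes card: "CARD('a::finite_field) = Suc k" and "e > 0"
  shows "(\<Sum>x\<in>UNIV. x ^ e) = (if k dvd e then - 1 else 0 :: 'a)"
proof (cases "k dvd e")
  case True
  have "x ^ e = 1" if "x \<noteq> 0" for x :: 'a
    using True finite_field_power_eq_1[OF card that] by (auto simp: power_mult)
  then have "(\<Sum>x\<in>UNIV. x ^ e) = (\<Sum>x\<in>UNIV - {0::'a}. 1 :: 'a)"
    using \<open>e > 0\<close> by (intro sum.mono_neutral_cong_right) auto
  also have "\<dots> = of_nat k"
    using card by (simp add: card_Diff_singleton)
  also have "\<dots> = (- 1 :: 'a)"
  proof -
    have "of_nat (Suc k) = (0::'a)"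
      using CHAR_dvd_CARD[where 'a='a] card by (metis of_nat_eq_0_iff_char_dvd)
    then show ?thesis by (simp add: eq_neg_iff_add_eq_0 add.commute)
  qed
  finally show ?thesis using True by simp
next
  case False
  define e' where "e' = e mod k"
  have k: "k > 0"
    using False card card_mono[of "UNIV :: 'a set" "{0, 1}"] by (cases k) auto
  have e': "0 < e'" "e' < k"
    using False k by (auto simp: e'_def mod_greater_zero_iff_not_dvd)
  \<comment> \<open>The reduced exponent satisfies 0 < e' < k, so the k nonzero elements cannot all
    be roots of X^e' - 1.\<close>
  have "\<exists>g::'a. g \<noteq> 0 \<and> g ^ e' \<noteq> 1"
  proof (rule ccontr)
    assume "\<not> ?thesis"
    then have "UNIV - {0::'a} \<subseteq> {x. x ^ e' = 1}" by auto
    then have "card (UNIV - {0::'a}) \<le> card {x::'a. x ^ e' = 1}"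
      by (intro card_mono) auto
    also have "\<dots> \<le> e'"
      using e' by (intro card_power_eq_1_le)
    finally show False
      using card e' by (simp add: card_Diff_singleton)
  qed
  then obtain g :: 'a where g: "g \<noteq> 0" "g ^ e' \<noteq> 1" by blast
  have "x ^ e = x ^ (k * (e div k) + e')" for x :: 'a
    by (simp add: e'_def)
  then have "g ^ e = g ^ e'"
    using finite_field_power_eq_1[OF card g(1)] by (simp add: power_add power_mult)
  have "(\<Sum>x\<in>UNIV. x ^ e) = (\<Sum>x\<in>UNIV. (g * x) ^ e)"
    by (rule sum.reindex_bij_witness[of _ "\<lambda>x. g * x" "\<lambda>x. x / g"]) (use g in auto)
  also have "\<dots> = g ^ e * (\<Sum>x\<in>UNIV. x ^ e)"
    by (simp add: power_mult_distrib sum_distrib_left)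
  finally have "(g ^ e - 1) * (\<Sum>x\<in>UNIV. x ^ e) = 0"
    by (simp add: algebra_simps)
  then show ?thesis
    using g False \<open>g ^ e = g ^ e'\<close> by simp
qed

section \<open>Central binomial coefficients modulo a prime\<close>

text \<open>The multiples of p among 1, ..., pn + d are p, 2p, ..., np, with product p^n n!. The
  remaining factors form the unit u modulo p.\<close>

lemma fact_prime_factorization_step:
  assumes "prime (p::nat)" "d < p"
  obtains u :: nat where "fact (p * n + d) = p ^ n * fact n * u" "\<not> p dvd u"
proof -
  have "\<exists>u::nat. fact (p * n + d) = p ^ n * fact n * u \<and> \<not> p dvd u"
    using assms(2)
  proof (induction n arbitrary: d)
    case 0
    then show ?case
      using assms(1) by (auto simp: prime_dvd_fact_iff)
  next
    case (Suc n)
    from \<open>d < p\<close> show ?case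
    proof (induction d)
      case 0
      have "p > 0" using assms(1) prime_gt_0_nat by blast
      then obtain u :: nat where u: "fact (p * n + (p - 1)) = p ^ n * fact n * u" "\<not> p dvd u"
        using Suc.IH[of "p - 1"] by auto
      \<comment> \<open>Entering a new block adds the single factor p (n + 1), which the term p^n n!
        absorbs; u stays the same.\<close>
      have "p * Suc n + 0 = Suc (p * n + (p - 1))"
        using \<open>p > 0\<close> by (simp add: algebra_simps)
      then have "fact (p * Suc n + 0) = (p * Suc n) * (fact (p * n + (p - 1)) :: nat)"
        by (metis add.right_neutral fact_Suc of_nat_id)
      then show ?case
        using u by (intro exI[of _ u]) (simp add: algebra_simps)
    next
      case (Suc d)
      then obtain u :: nat where u: "fact (p * Suc n + d) = p ^ Suc n * fact (Suc n) * u" "\<not> p dvd u"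
        by auto
      have "\<not> p dvd Suc d"
        using Suc.prems by (auto dest: dvd_imp_le)
      then have "\<not> p dvd p * Suc n + Suc d"
        by (metis dvd_add_right_iff dvd_triv_left)
      then have "\<not> p dvd (p * Suc n + Suc d) * u"
        using u(2) assms(1) by (simp only: prime_dvd_mult_iff) simp
      moreover have "fact (p * Suc n + Suc d) = (p * Suc n + Suc d) * (fact (p * Suc n + d) :: nat)"
        by (metis add_Suc_right fact_Suc of_nat_id)
      then have "fact (p * Suc n + Suc d) = p ^ Suc n * fact (Suc n) * ((p * Suc n + Suc d) * u)"
        unfolding u(1) by (simp only: mult_ac)
      ultimately show ?case by blast
    qed
  qed
  then show ?thesis using that by blast
qed

text \<open>A case of Lucas' theorem, by induction over base-p digits: every digit of m is (p -
  1)/4, so doubling m causes no carry.\<close>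

lemma not_dvd_central_binomial:
  assumes "prime (p::nat)" "p mod 4 = 1"
  shows "4 * m = p ^ r - 1 \<Longrightarrow> \<not> p dvd (2 * m choose m)"
proof (induction r arbitrary: m)
  case 0
  then show ?case
    using assms(1) by auto
next
  case (Suc r)
  \<comment> \<open>d = (p - 1)/4 is the last base-p digit of m, and m0 = (p^r - 1)/4 consists of
    the others. Since 2d < p, the factorial lemma applies to both m and 2m.\<close>
  define d where "d = p div 4"
  have d: "p = 4 * d + 1"
    using assms(2) div_mult_mod_eq[of p 4] by (simp add: d_def)
  have "p ^ r mod 4 = 1"
    using assms(2) power_mod[of p 4 r] by simp
  moreover define m0 where "m0 = p ^ r div 4"
  ultimately have m0: "p ^ r = 4 * m0 + 1"
    using div_mult_mod_eq[of "p ^ r" 4] by simp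
  then have "4 * m = 4 * (p * m0 + d)"
    using Suc.prems d by (simp add: m0 algebra_simps)
  then have m: "m = p * m0 + d" "2 * m = p * (2 * m0) + 2 * d" by simp_all
  have dp: "d < p" "2 * d < p" using d by simp_all
  obtain u :: nat where u: "fact m = p ^ m0 * fact m0 * u" "\<not> p dvd u"
    using fact_prime_factorization_step[OF assms(1) dp(1), of m0] m by metis
  obtain v :: nat where v: "fact (2 * m) = p ^ (2 * m0) * fact (2 * m0) * v" "\<not> p dvd v"
    using fact_prime_factorization_step[OF assms(1) dp(2), of "2 * m0"] m by metis
  have fact_eq: "fact k * fact k * (2 * k choose k) = (fact (2 * k) :: nat)" for k :: nat
    using binomial_fact_lemma[of k "2 * k"] by simp
  have "p ^ (2 * m0) = p ^ m0 * p ^ m0"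
    by (simp add: mult_2 power_add)
  then have "p ^ (2 * m0) * (fact m0 * fact m0) * (u * u * (2 * m choose m)) = fact (2 * m)"
    unfolding fact_eq[of m, symmetric] u(1) by (simp only: mult_ac)
  also have "\<dots> = p ^ (2 * m0) * (fact m0 * fact m0) * ((2 * m0 choose m0) * v)"
    unfolding v(1) fact_eq[of m0, symmetric] by (simp add: mult_ac)
  \<comment> \<open>The powers of p and the factorials of m0 cancel. A factor p on the left would
    have to divide the right side, against the induction hypothesis and the choice of v.\<close>
  finally have "u * u * (2 * m choose m) = (2 * m0 choose m0) * v"
    using assms(1) by (auto simp: prime_gt_0_nat)
  moreover have "\<not> p dvd (2 * m0 choose m0) * v"
    using Suc.IH[of m0] m0 v(2) assms(1) by (simp add: prime_dvd_mult_iff)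
  ultimately show ?case
    by (metis dvd_mult)
qed

section \<open>Counting points\<close>

lemma card_rational_points:
  "card (rational_points (Curve a b :: 'a::finite_field curve))
    = 1 + (\<Sum>x\<in>UNIV. card {y. y ^ 2 = x ^ 3 + a * x + b})"
proof -
  let ?S = "SIGMA x:UNIV. {y. y ^ 2 = x ^ 3 + a * x + b}"
  have "rational_points (Curve a b) = insert Infinity ((\<lambda>(x, y). Affine x y) ` ?S)"
    by (auto simp: rational_points_def)
  moreover have "card ((\<lambda>(x, y). Affine x y) ` ?S) = card ?S"
    by (intro card_image) (auto simp: inj_on_def)
  moreover have "Infinity \<notin> (\<lambda>(x, y). Affine x y) ` ?S" by auto
  moreover have "card ?S = (\<Sum>x\<in>UNIV. card {y. y ^ 2 = x ^ 3 + a * x + b})"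
    by (rule card_SigmaI) auto
  ultimately show ?thesis by simp
qed

text \<open>The twist's cubic at e x is e^3 times the original cubic at x. As e^3 is not a square,
  the points over x and those over e x on the twist together number 2; the two points at infinity
  complete the total.\<close>

lemma card_rational_points_quadratic_twist:
  fixes a b e :: "'a::finite_field"
  assumes "odd CARD('a)" "\<not> is_square e"
  shows "card (rational_points (Curve a b)) + card (rational_points (Curve (a * e ^ 2) (b * e ^ 3)))
    = 2 * CARD('a) + 2"
proof -
  let ?f = "\<lambda>x. x ^ 3 + a * x + b" and ?N = "\<lambda>c::'a. card {y. y ^ 2 = c}"
  have "e \<noteq> 0" using assms(2) by auto
  have twist: "?N c + ?N (e ^ 3 * c) = 2" for c
  proof -
    have "is_square (e ^ 3 * c) \<longleftrightarrow> \<not> is_square c" if "c \<noteq> 0"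
    proof -
      have "e ^ 3 * c = e ^ 2 * (e * c)"
        by (simp add: power2_eq_square power3_eq_cube)
      then show ?thesis
        using assms that \<open>e \<noteq> 0\<close> by (simp add: is_square_mult_iff)
    qed
    then show ?thesis
      using assms(1) \<open>e \<noteq> 0\<close> by (simp add: card_square_roots)
  qed
  have "(\<Sum>x\<in>UNIV. ?N (x ^ 3 + a * e ^ 2 * x + b * e ^ 3)) = (\<Sum>x\<in>UNIV. ?N (e ^ 3 * ?f x))"
  proof (rule sum.reindex_bij_witness[of _ "\<lambda>x. e * x" "\<lambda>x. x / e"])
    fix x
    have "x ^ 3 + a * e ^ 2 * x + b * e ^ 3 = e ^ 3 * ?f (x / e)"
      using \<open>e \<noteq> 0\<close> by (simp add: field_simps power2_eq_square power3_eq_cube)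
    then show "?N (e ^ 3 * ?f (x / e)) = ?N (x ^ 3 + a * e ^ 2 * x + b * e ^ 3)" by simp
  qed (use \<open>e \<noteq> 0\<close> in auto)
  then have "(\<Sum>x\<in>UNIV. ?N (?f x)) + (\<Sum>x\<in>UNIV. ?N (x ^ 3 + a * e ^ 2 * x + b * e ^ 3))
      = (\<Sum>x\<in>UNIV. ?N (?f x) + ?N (e ^ 3 * ?f x))"
    by (simp add: sum.distrib)
  also have "\<dots> = (\<Sum>x\<in>(UNIV :: 'a set). 2)"
    by (simp only: twist)
  finally show ?thesis
    by (simp add: card_rational_points)
qed

text \<open>Pairs {x, h x} are removed one by one. An infinite set has \<open>card\<close> 0, which
  is even.\<close>

lemma even_card_fixpoint_free_involution:
  assumes "\<And>x. x \<in> X \<Longrightarrow> h x \<in> X" "\<And>x. x \<in> X \<Longrightarrow> h (h x) = x" "\<And>x. x \<in> X \<Longrightarrow> h x \<noteq> x"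
  shows "even (card X)"
proof (cases "finite X")
  case True
  then show ?thesis
    using assms
  proof (induction X rule: finite_psubset_induct)
    case (psubset X)
    show ?case
    proof (cases "X = {}")
      case False
      then obtain x where x: "x \<in> X" by blast
      then have hx: "h x \<in> X" "h (h x) = x" "h x \<noteq> x"
        using psubset.prems by blast+
      have "even (card (X - {x, h x}))"
      proof (rule psubset.IH)
        show "X - {x, h x} \<subset> X" using x by blast
        show "h y \<in> X - {x, h x}" if "y \<in> X - {x, h x}" for y
          using that psubset.prems(1,2) hx by (metis DiffD1 DiffD2 DiffI insert_iff empty_iff)
      qed (use psubset.prems in blast)+
      moreover have "card X = card (X - {x, h x}) + card {x, h x}"
        using x hx psubset.hyps card_Un_disjoint[of "X - {x, h x}" "{x, h x}"]
        by (metis Diff_disjoint Diff_partition Int_commute Un_commute bot_least finite.emptyI finite_Diff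
          finite_insert insert_subset)
      ultimately show ?thesis using hx(3) by simp
    qed simp
  qed
qed simp

text \<open>As -1 is a square and the cubic is odd, x \<mapsto> -x pairs the x-coordinates of points
  with y \<noteq> 0, so these points come in fours. The count modulo 4 is left to infinity and the
  points with y = 0, where x = 0 or x^2 = -a.\<close>

lemma card_rational_points_1728_mod_4:
  fixes a :: "'a::finite_field"
  assumes "CARD('a) mod 4 = 1" "a \<noteq> 0"
  shows "card (rational_points (Curve a 0)) mod 4 = (if is_square a then 0 else 2)"
proof -
  let ?f = "\<lambda>x. x ^ 3 + a * x"
  obtain m where m: "CARD('a) = 4 * m + 1"
    using assms(1) by (metis div_mult_mod_eq mult.commute)
  then have odd: "odd CARD('a)" by simp
  have "(- 1 :: 'a) ^ (2 * m) = 1" by simp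
  then have sq: "is_square (- 1 :: 'a)"
    using euler_criterion_finite_field[of "2 * m" "- 1 :: 'a"] m finite_field_two_neq_0[OF odd]
    by (metis add.right_inverse minus_equation_iff mult.assoc mult_2 numeral_Bit0 one_add_one neg_equal_0_iff_equal zero_neq_one)
  have neg: "is_square (- c) \<longleftrightarrow> is_square c" if "c \<noteq> 0" for c :: 'a
    using is_square_mult_iff[OF odd, of "- 1" c] sq that by simp
  define Z where "Z = {x. ?f x = 0}"
  define X where "X = {x. ?f x \<noteq> 0 \<and> is_square (?f x)}"
  have f_minus: "(- x) ^ 3 + a * - x = - ?f x" for x by simp
  have "even (card X)"
  proof (rule even_card_fixpoint_free_involution[of _ uminus])
    fix x assume x: "x \<in> X"
    then show "- x \<in> X"
      using neg[of "?f x"] unfolding X_def mem_Collect_eq f_minus neg_equal_0_iff_equal by blast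
    show "- x \<noteq> x"
    proof
      assume "- x = x"
      then have "2 * x = 0" by (metis add.right_inverse mult_2)
      then show False
        using x finite_field_two_neq_0[OF odd] by (simp add: X_def)
    qed
  qed simp
  have "Z = insert 0 {x. x ^ 2 = - a}"
  proof -
    have "?f x = x * (x ^ 2 + a)" for x
      by (simp add: algebra_simps power2_eq_square power3_eq_cube)
    then show ?thesis
      unfolding Z_def by (auto simp: add_eq_0_iff2)
  qed
  then have "card Z = Suc (card {x. x ^ 2 = - a})"
    using assms(2) by simp
  then have Z: "card Z = (if is_square a then 3 else 1)"
    using card_square_roots[OF odd, of "- a"] assms(2) neg[of a] by simp
  have "(\<Sum>x\<in>UNIV. card {y. y ^ 2 = ?f x})
      = (\<Sum>x\<in>UNIV. (if x \<in> Z then 1 else 0) + (if x \<in> X then 2 else 0))"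
    using card_square_roots[OF odd] by (intro sum.cong) (auto simp: X_def Z_def)
  also have "\<dots> = card Z + 2 * card X"
    by (simp add: sum.distrib flip: sum.inter_filter)
  finally have "card (rational_points (Curve a 0)) = 1 + card Z + 2 * card X"
    using card_rational_points[of a 0] by simp
  moreover obtain k where "card X = 2 * k"
    using \<open>even (card X)\<close> by (elim evenE)
  ultimately show ?thesis
    using Z by auto
qed

text \<open>In the field, the number of square roots of c is 1 + c^((q-1)/2). Expanding (x^3 + a
  x)^(2m) and summing over x leaves only the monomial x^(q-1); its coefficient plays the part of the
  Hasse invariant.\<close>

lemma of_nat_card_rational_points_1728:
  fixes a :: "'a::finite_field"
  assumes m: "CARD('a) = 4 * m + 1"
  shows "(of_nat (card (rational_points (Curve a 0))) :: 'a) = 1 - of_nat (2 * m choose m) * a ^ m"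
proof -
  let ?f = "\<lambda>x. x ^ 3 + a * x"
  have odd: "odd CARD('a)" using m by simp
  have "CARD('a) > 1"
    using card_mono[of "UNIV :: 'a set" "{0, 1}"] by simp
  then have "m > 0" using m by simp
  \<comment> \<open>For c = 0 this needs m > 0, so that 0^(2m) = 0.\<close>
  have roots: "of_nat (card {y. y ^ 2 = c}) = 1 + c ^ (2 * m)" for c :: 'a
    using euler_criterion_finite_field[of "2 * m" c] m \<open>m > 0\<close> card_square_roots[OF odd, of c]
    by (cases "c = 0") auto
  have monomial: "(\<Sum>x\<in>UNIV. (x ^ 3) ^ k * (a * x) ^ (2 * m - k))
      = (if k = m then - (a ^ m) else 0)" if "k \<le> 2 * m" for k
  proof -
    have "(x ^ 3) ^ k * (a * x) ^ (2 * m - k) = a ^ (2 * m - k) * x ^ (2 * m + 2 * k)" for x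
      using that by (simp add: power_mult_distrib add.commute flip: power_mult power_add)
    then have "(\<Sum>x\<in>UNIV. (x ^ 3) ^ k * (a * x) ^ (2 * m - k))
        = a ^ (2 * m - k) * (\<Sum>x\<in>UNIV. x ^ (2 * m + 2 * k))"
      by (simp add: sum_distrib_left)
    also have "(\<Sum>x\<in>UNIV. x ^ (2 * m + 2 * k)) = (if 4 * m dvd 2 * m + 2 * k then - 1 else 0 :: 'a)"
      using m \<open>m > 0\<close> by (intro sum_powers_finite_field) auto
    \<comment> \<open>The exponent lies between 2m and 6m, where 4m is the only multiple of
      4m.\<close>
    also have "4 * m dvd 2 * m + 2 * k \<longleftrightarrow> k = m"
    proof
      assume "4 * m dvd 2 * m + 2 * k"
      then obtain j where j: "2 * m + 2 * k = 4 * m * j" by (elim dvdE)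
      have "j = 1"
      proof (rule ccontr)
        assume "j \<noteq> 1"
        then consider "j = 0" | "j \<ge> 2" by linarith
        then show False
        proof cases
          case 2
          then have "4 * m * 2 \<le> 4 * m * j" by (intro mult_left_mono) auto
          then show False using j that \<open>m > 0\<close> by linarith
        qed (use j \<open>m > 0\<close> in simp)
      qed
      then show "k = m" using j by simp
    qed simp
    finally show ?thesis by simp
  qed
  have "(\<Sum>x\<in>UNIV. ?f x ^ (2 * m))
      = (\<Sum>x\<in>UNIV. \<Sum>k\<le>2 * m. of_nat (2 * m choose k) * (x ^ 3) ^ k * (a * x) ^ (2 * m - k))"
    by (simp add: binomial_ring)
  also have "\<dots> = (\<Sum>k\<le>2 * m. of_nat (2 * m choose k)
      * (\<Sum>x\<in>UNIV. (x ^ 3) ^ k * (a * x) ^ (2 * m - k)))"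
    by (subst sum.swap) (simp add: sum_distrib_left mult.assoc)
  also have "\<dots> = (\<Sum>k\<le>2 * m. if k = m then - (of_nat (2 * m choose m) * a ^ m) else 0)"
    using monomial by (intro sum.cong) auto
  also have "\<dots> = - (of_nat (2 * m choose m) * a ^ m)"
    by simp
  finally have "(\<Sum>x\<in>UNIV. ?f x ^ (2 * m)) = - (of_nat (2 * m choose m) * a ^ m)" .
  moreover have "of_nat (CARD('a)) = (0::'a)"
    using CHAR_dvd_CARD[where 'a='a] by (simp only: of_nat_eq_0_iff_char_dvd)
  ultimately show ?thesis
    using card_rational_points[of a 0] by (simp add: roots sum.distrib)
qed

text \<open>Supersingularity makes the term with the central binomial coefficient vanish, so p
  divides that coefficient; this is impossible when p is 1 modulo 4.\<close>

lemma supersingular_1728_mod_4: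
  fixes a :: "'a::finite_field"
  assumes "supersingular (Curve a 0)" "a \<noteq> 0"
    and "CARD('a) = p ^ r" "CARD('a) mod 4 = 1" "CHAR('a) = p"
  shows "p mod 4 = 3"
proof (rule ccontr)
  assume "p mod 4 \<noteq> 3"
  define m where "m = CARD('a) div 4"
  have m: "CARD('a) = 4 * m + 1"
    using assms(4) div_mult_mod_eq[of "CARD('a)" 4] by (simp add: m_def)
  have "prime p" using assms(5) CHAR_prime by metis
  have "r > 0"
    using assms(3) card_mono[of "UNIV :: 'a set" "{0, 1}"] by (cases r) auto
  have "odd (p ^ r)" using m assms(3) by simp
  then have "odd p" using \<open>r > 0\<close> by simp
  then have "p mod 4 = 1"
    using \<open>p mod 4 \<noteq> 3\<close> by presburger
  then have "\<not> p dvd (2 * m choose m)"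
    using not_dvd_central_binomial[OF \<open>prime p\<close>, of m r] m assms(3) by simp
  moreover have "of_nat (card (rational_points (Curve a 0))) = (of_nat 1 :: 'a)"
    using assms(1) unfolding supersingular_def of_nat_eq_iff_cong_CHAR .
  then have "of_nat (2 * m choose m) = (0 :: 'a)"
    using of_nat_card_rational_points_1728[OF m, of a] assms(2) by simp
  ultimately show False
    using assms(5) by (simp add: of_nat_eq_0_iff_char_dvd)
qed

section \<open>Curves with \<open>j\<close>-invariant 1728\<close>

lemma j_invariant_1728:
  fixes E :: "'a::finite_field curve"
  assumes "CHAR('a) > 3" "elliptic_curve E" "j_invariant E = 1728"
  obtains a where "E = Curve a 0" "a \<noteq> 0"
proof -
  obtain a b where E: "E = Curve a b" by (cases E)
  have numeral: "(2::'a) \<noteq> 0" "(3::'a) \<noteq> 0"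
  proof -
    have "(of_nat k :: 'a) \<noteq> 0" if "0 < k" "k < 4" for k
      using assms(1) that by (auto simp: of_nat_eq_0_iff_char_dvd dest: dvd_imp_le)
    from this[of 2] this[of 3] show "(2::'a) \<noteq> 0" "(3::'a) \<noteq> 0" by simp_all
  qed
  have "(1728::'a) = 2 ^ 6 * 3 ^ 3" by simp
  then have "1728 \<noteq> (0::'a)" using numeral by (metis mult_eq_0_iff power_not_zero)
  then have "4 * a ^ 3 / (4 * a ^ 3 + 27 * b ^ 2) = 1"
    using assms(3) \<open>1728 \<noteq> 0\<close>
    unfolding E j_invariant_def by (metis curve.sel mult_cancel_left mult.right_neutral)
  \<comment> \<open>A zero denominator would make the quotient 0 instead of 1, so numerator and
    denominator agree.\<close>
  then have "27 * b ^ 2 = 0"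
    by (metis add_cancel_right_right div_by_0 divide_eq_1_iff zero_neq_one)
  moreover have "(27::'a) = 3 ^ 3" by simp
  then have "(27::'a) \<noteq> 0" using numeral by (metis power_not_zero)
  ultimately have "b = 0" by simp
  moreover from this have "a \<noteq> 0" using assms(2) by (auto simp: E elliptic_curve_def)
  ultimately show ?thesis using that E by blast
qed

lemma point_group_iso_1728:
  fixes a b :: "'a::finite_field"
  assumes q: "CARD('a) mod 4 = 1" and p: "CHAR('a) mod 4 = 3"
    and "a \<noteq> 0" "b \<noteq> 0"
    and card: "card (rational_points (Curve a 0)) = card (rational_points (Curve b 0))"
  shows "point_group (Curve a 0) \<cong> point_group (Curve b 0)"
proof -
  have odd: "odd CARD('a)" using q by presburger
  \<comment> \<open>Shared by both cases: with d = u^2, scaling by u multiplies the coefficient by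
    u^4 = d^2.\<close>
  have iso: "point_group (Curve a 0) \<cong> point_group (Curve b 0)"
    if "field_automorphism f" "b = d ^ 2 * f a" "is_square d" for f :: "'a \<Rightarrow> 'a" and d
  proof -
    obtain u where "d = u ^ 2"
      using \<open>is_square d\<close> by (elim is_nth_powerE)
    then have "b = u ^ 4 * f a" "u \<noteq> 0"
      using that(2) \<open>b \<noteq> 0\<close> by (auto simp flip: power_mult)
    then show ?thesis
      using field_automorphism.point_group_iso[OF that(1), of u a 0] field_automorphism.zero[OF that(1)]
      by simp
  qed
  have "is_square a \<longleftrightarrow> is_square b"
    using card_rational_points_1728_mod_4[OF q \<open>a \<noteq> 0\<close>] card_rational_points_1728_mod_4[OF q \<open>b \<noteq> 0\<close>]
      card by (simp split: if_splits)
  then have "is_square (a * b)"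
    using is_square_mult_iff[OF odd \<open>a \<noteq> 0\<close> \<open>b \<noteq> 0\<close>] by simp
  then obtain s where s: "a * b = s ^ 2" by (elim is_nth_powerE)
  define e where "e = s / a"
  have b: "b = e ^ 2 * a" and "e \<noteq> 0"
    using s \<open>a \<noteq> 0\<close> \<open>b \<noteq> 0\<close> by (auto simp: e_def field_simps power2_eq_square)
  show ?thesis
  proof (cases "is_square e")
    case True
    then show ?thesis using iso[OF field_automorphism_id b] by simp
  next
    case False
    \<comment> \<open>Since b = e^2 a, the second curve is the quadratic twist of the first by the
      nonsquare e.\<close>
    have "2 * card (rational_points (Curve a 0)) = 2 * CARD('a) + 2"
      using card_rational_points_quadratic_twist[OF odd False, of a 0] card b by (simp add: mult.commute)
    then have "card (rational_points (Curve a 0)) = CARD('a) + 1" by simp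
    then have "card (rational_points (Curve a 0)) mod 4 = 2"
      using q by presburger
    then have "\<not> is_square a"
      using card_rational_points_1728_mod_4[OF q \<open>a \<noteq> 0\<close>] by auto
    define k where "k = CHAR('a) div 4"
    have k: "CHAR('a) = 4 * k + 3"
      using p div_mult_mod_eq[of "CHAR('a)" 4] by (simp add: k_def)
    \<comment> \<open>Chosen so that b = d^2 a^p, because p = 2 (2k + 1) + 1. The exponent 2k + 1 is
      odd, so d equals e a up to a square, and e a is a square as a product of two
      nonsquares.\<close>
    define d where "d = e / a ^ (2 * k + 1)"
    have "d * (a ^ (k + 1)) ^ 2 = e * a"
      using \<open>a \<noteq> 0\<close> by (simp add: d_def field_simps flip: power_mult power_Suc)
    moreover have "d \<noteq> 0" using \<open>e \<noteq> 0\<close> \<open>a \<noteq> 0\<close> by (simp add: d_def)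
    ultimately have "is_square d \<longleftrightarrow> is_square (e * a)"
      using is_square_mult_iff[OF odd, of d "(a ^ (k + 1)) ^ 2"] \<open>a \<noteq> 0\<close> by simp
    then have "is_square d"
      using is_square_mult_iff[OF odd \<open>e \<noteq> 0\<close> \<open>a \<noteq> 0\<close>] False \<open>\<not> is_square a\<close> by simp
    moreover have "b = d ^ 2 * a ^ CHAR('a)"
    proof -
      have "a ^ CHAR('a) = (a ^ (2 * k + 1)) ^ 2 * a"
        by (simp add: k power_add eval_nat_numeral flip: power_mult)
      then show ?thesis using \<open>a \<noteq> 0\<close> by (simp add: b d_def power_divide)
    qed
    ultimately show ?thesis using iso[OF field_automorphism_Frobenius] by blast
  qed
qed

theorem theorem5p5:
  fixes p r :: nat
    and E1 E2 :: "'a::finite_field curve"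
  assumes "prime p" and "p > 3"
    and "CARD('a) = p ^ r" and "even r"
    and "elliptic_curve E1" and "elliptic_curve E2"
    and "supersingular E1" and "supersingular E2"
    and "j_invariant E1 = 1728" and "j_invariant E2 = 1728"
  shows "card (rational_points E1) = card (rational_points E2)
           \<longleftrightarrow> point_group E1 \<cong> point_group E2"
proof
  assume card: "card (rational_points E1) = card (rational_points E2)"
  have "CHAR('a) dvd p ^ r"
    using CHAR_dvd_CARD[where 'a='a] assms(3) by simp
  then have p: "CHAR('a) = p"
    using assms(1) CHAR_prime by (metis prime_dvd_power primes_dvd_imp_eq)
  have "odd p"
    using assms(1,2) prime_odd_nat by simp
  \<comment> \<open>Evenness of r makes q a power of p^2, which is 1 modulo 4 for odd p.\<close>
  obtain s where "r = 2 * s"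
    using assms(4) by (elim evenE)
  then have "CARD('a) = (p ^ 2) ^ s"
    using assms(3) by (simp flip: power_mult)
  moreover have "p ^ 2 mod 4 = 1"
  proof -
    obtain k where "p = 2 * k + 1" using \<open>odd p\<close> by (elim oddE)
    then have "p ^ 2 = 4 * (k ^ 2 + k) + 1"
      by (simp add: algebra_simps power2_eq_square)
    then show ?thesis by simp
  qed
  ultimately have q: "CARD('a) mod 4 = 1"
    using power_mod[of "p ^ 2" 4 s] by simp
  obtain a b where E: "E1 = Curve a 0" "a \<noteq> 0" "E2 = Curve b 0" "b \<noteq> 0"
    using j_invariant_1728 assms p by metis
  have "p mod 4 = 3"
    using supersingular_1728_mod_4[of a p r] E assms q p by simp
  then show "point_group E1 \<cong> point_group E2"
    using point_group_iso_1728[OF q _ E(2,4)] card E p by simp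
next
  assume "point_group E1 \<cong> point_group E2"
  then show "card (rational_points E1) = card (rational_points E2)"
    by (auto simp: is_iso_def iso_def point_group_def dest: bij_betw_same_card)
qed

end
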